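(* Let $n \geq 3$, let $p(z)=\sum_{j=0}^{n} a_j z^j$ be a real polynomial with positive coefficients $a_0,\dots,a_n>0$, let $0<\varepsilon\leq 1$, and define $$\gamma_2=\frac{(1-\varepsilon)a_{n-1}}{a_n},\quad \gamma_1=\frac{a_{n-2}-\gamma_2 a_{n-1}}{a_n},$$ and $$\gamma_0=\max\left\{0,\ \frac{\gamma_1 a_0}{-a_1},\ \frac{\gamma_2 a_0+\gamma_1 a_1}{-a_2},\ \max_{0\leq j\leq n-3}\frac{a_j-\gamma_2 a_{j+1}-\gamma_1 a_{j+2}}{a_{j+3}}\right\}.$$ Let $\mu$ be the unique positive zero of $z^3-\gamma_2 z^2-\gamma_1 z-\gamma_0$, and let $R=\mu^3+\left(\varepsilon\frac{a_{n-1}}{a_n}\right)\mu^2$. Then all the zeros of $p$ are included in the union of disks $$\{z\in\mathbb{C}:|z|\leq R^{1/3}\}\ \cup\ \left\{z\in\mathbb{C}:\left|z+\varepsilon\frac{a_{n-1}}{a_n}\right|\leq R^{1/3}\right\}.$$ If the two disks are disjoint, then the disk centered at $-\varepsilon a_{n-1}/a_n$ contains one zero of $p$ and the one centered at the origin contains the remaining $n-1$ zeros of $p$.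
   Context: Zeros are complex zeros, counted with multiplicity. *)

theory Defs
  imports Complex_Main "HOL-Computational_Algebra.Computational_Algebra"
begin

end

theory Submission
  imports Defs "HOL-Complex_Analysis.Residue_Theorem"
begin

text \<open>
  The cubic \<open>q(z) = z\<^sup>3 - \<gamma>2 z\<^sup>2 - \<gamma>1 z - \<gamma>0\<close> is a multiplier that
  simplifies \<open>p\<close>: \<open>\<gamma>2\<close> lowers the coefficient of \<open>z\<^bsup>n+2\<^esup>\<close> in \<open>q p\<close> to
  \<open>a\<^sub>n s\<close> with \<open>s = \<epsilon> a\<^bsub>n-1\<^esub> / a\<^sub>n\<close>, \<open>\<gamma>1\<close> removes the coefficient of
  \<open>z\<^bsup>n+1\<^esup>\<close>, and \<open>\<gamma>0\<close> is the least nonnegative number that makes all lower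
  coefficients nonpositive. Hence (\<open>cubic_mult_poly\<close>)
  \<open>q(z) p(z) = a\<^sub>n z\<^bsup>n+2\<^esup> (z + s) - (\<Sum>j\<le>n. c\<^sub>j z\<^sup>j)\<close> with all \<open>c\<^sub>j \<ge> 0\<close>.

  The signs of these coefficients change once, so \<open>q p\<close>, and with it \<open>q\<close>, has at most one
  positive zero (\<open>positive_zero_unique\<close>); this holds even when \<open>\<gamma>1\<close> is negative and the
  coefficients of \<open>q\<close> itself change sign three times. Existence is an intermediate value
  argument.

  Beyond \<open>\<mu>\<close> the sum grows at most like \<open>\<bar>z\<bar>\<^sup>n\<close>, and at \<open>\<mu>\<close> it equals
  \<open>a\<^sub>n R \<mu>\<^sup>n\<close>, so it is bounded by \<open>a\<^sub>n R \<bar>z\<bar>\<^sup>n\<close> for \<open>\<bar>z\<bar> \<ge> \<mu>\<close>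
  (\<open>tail_bound_beyond_positive_zero\<close>). With \<open>\<rho>\<^sup>3 = R\<close>, a point outside both disks
  satisfies \<open>\<bar>z\<bar>\<^sup>2 \<bar>z + s\<bar> > \<rho>\<^sup>3 = R\<close> and \<open>\<bar>z\<bar> > \<rho> \<ge> \<mu>\<close>. There the
  leading part strictly dominates the sum, and \<open>p\<close> cannot vanish.

  If the disks are disjoint, then \<open>s > 2 \<rho>\<close>, and the circle of radius \<open>s / 2\<close> about \<open>-s\<close>
  lies outside both. By Rouche's theorem \<open>q p\<close> has as many zeros inside it as
  \<open>z\<^bsup>n+2\<^esup> (z + s)\<close>, namely one. This zero belongs to \<open>p\<close>, because every zero of \<open>q\<close> has
  real part at least \<open>-\<mu>\<close> (\<open>cubic_zero_Re_ge\<close>), which is to the right of the circle.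
\<close>

section \<open>Rouche's theorem for polynomials\<close>

lemma zorder_poly_eq_order:
  fixes P :: "complex poly"
  assumes "P \<noteq> 0"
  shows "zorder (poly P) z = int (order z P)"
proof -
  obtain S where S: "P = [:-z, 1:] ^ order z P * S" "\<not> [:-z, 1:] dvd S"
    using order_decomp[OF assms] by blast
  show ?thesis
  proof (rule zorder_eqI[where g = "poly S" and S = UNIV])
    show "poly S z \<noteq> 0"
      using S(2) by (simp add: poly_eq_0_iff_dvd)
    show "poly P w = poly S w * (w - z) powi int (order z P)" for w
    proof -
      have "poly P w = poly ([:-z, 1:] ^ order z P * S) w"
        using S(1) by simp
      also have "\<dots> = poly S w * (w - z) powi int (order z P)"
        by (simp add: poly_power)
      finally show ?thesis .
    qed
  qed (auto intro!: holomorphic_intros)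
qed

text \<open>
  The weighted count of zeros in the general form of Rouche's theorem is, for a circle, the number
  of zeros enclosed: the winding number is one inside and zero outside.
\<close>

lemma sum_winding_number_zorder_poly:
  fixes P :: "complex poly"
  assumes P: "P \<noteq> 0" and circle: "\<And>z. z \<in> sphere c r \<Longrightarrow> poly P z \<noteq> 0" and r: "r > 0"
  shows "(\<Sum>z\<in>{z\<in>UNIV. poly P z = 0}. winding_number (circlepath c r) z * zorder (poly P) z)
           = of_nat (size (filter_mset (\<lambda>z. z \<in> ball c r) (proots P)))"
proof -
  let ?Z = "{z\<in>UNIV. poly P z = 0}"
  have fin: "finite ?Z"
    using P by (simp add: poly_roots_finite)
  have term_eq: "winding_number (circlepath c r) z * zorder (poly P) z
      = (if z \<in> ball c r then of_nat (order z P) else 0)" if "z \<in> ?Z" for z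
  proof (cases "z \<in> ball c r")
    case True
    then have "winding_number (circlepath c r) z = 1"
      by (intro winding_number_circlepath) (simp add: dist_norm norm_minus_commute)
    with True P show ?thesis
      by (simp add: zorder_poly_eq_order)
  next
    case False
    with that circle[of z] have "z \<notin> cball c r"
      by (auto simp: less_eq_real_def)
    then have "winding_number (circlepath c r) z = 0"
      using r by (intro winding_number_zero_outside[where s = "cball c r"])
        (auto simp: valid_path_imp_path)
    with False show ?thesis by simp
  qed
  have "size (filter_mset (\<lambda>z. z \<in> ball c r) (proots P))
      = (\<Sum>z\<in>?Z \<inter> ball c r. order z P)"
    using P unfolding size_multiset_overloaded_eq
    by (intro sum.cong) (auto simp: set_mset_filter)
  then show ?thesis
    using term_eq fin by (simp add: sum.If_cases Int_def)
qed

lemma Rouche_theorem_poly: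
  fixes F G :: "complex poly"
  assumes r: "r > 0"
    and less: "\<And>z. z \<in> sphere c r \<Longrightarrow> cmod (poly G z) < cmod (poly F z)"
  shows "size (filter_mset (\<lambda>z. z \<in> ball c r) (proots (F + G)))
           = size (filter_mset (\<lambda>z. z \<in> ball c r) (proots F))"
proof -
  have F_circle: "poly F z \<noteq> 0" if "z \<in> sphere c r" for z
    using less[OF that] by auto
  have FG_circle: "poly (F + G) z \<noteq> 0" if "z \<in> sphere c r" for z
    using less[OF that] by (auto simp: add_eq_0_iff norm_minus_cancel)
  have "c + of_real r \<in> sphere c r"
    using r by (simp add: dist_norm)
  with F_circle FG_circle have nz: "F \<noteq> 0" "F + G \<noteq> 0"
    by (metis poly_0)+
  have "(\<Sum>z\<in>{z\<in>UNIV. poly F z + poly G z = 0}.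
          winding_number (circlepath c r) z * zorder (\<lambda>z. poly F z + poly G z) z)
      = (\<Sum>z\<in>{z\<in>UNIV. poly F z = 0}. winding_number (circlepath c r) z * zorder (poly F) z)"
  proof (rule Rouche_theorem)
    show "finite {z \<in> UNIV. poly F z + poly G z = 0}"
      using poly_roots_finite[OF nz(2)] by simp
    show "finite {z \<in> UNIV. poly F z = 0}"
      using poly_roots_finite[OF nz(1)] by simp
    show "\<forall>z\<in>path_image (circlepath c r). cmod (poly G z) < cmod (poly F z)"
      using less r by simp
  qed (auto intro!: holomorphic_intros)
  moreover have "(\<lambda>z. poly F z + poly G z) = poly (F + G)"
    by auto
  ultimately show ?thesis
    using sum_winding_number_zorder_poly[OF nz(1) F_circle r]
      sum_winding_number_zorder_poly[OF nz(2) FG_circle r]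
    by simp
qed

section \<open>The cubic multiplier\<close>

text \<open>
  The coefficient of \<open>z\<^sup>j\<close> in \<open>(g0 + g1 z + g2 z\<^sup>2 - z\<^sup>3) (\<Sum>i. a\<^sub>i z\<^sup>i)\<close>, that is,
  the negative of the one in the product with the multiplier: for the multiplier of the theorem
  these numbers are nonnegative. The guards keep the truncated subtraction on indices from
  repeating \<open>a\<^sub>0\<close>.
\<close>

definition cubic_tail :: "'a \<Rightarrow> 'a \<Rightarrow> 'a \<Rightarrow> (nat \<Rightarrow> 'a) \<Rightarrow> nat \<Rightarrow> 'a::comm_ring_1"
  where "cubic_tail g2 g1 g0 a j =
    g0 * a j + (if j \<ge> 1 then g1 * a (j - 1) else 0) + (if j \<ge> 2 then g2 * a (j - 2) else 0)
      - (if j \<ge> 3 then a (j - 3) else 0)"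

lemma cubic_mult_poly:
  fixes a :: "nat \<Rightarrow> 'a::comm_ring_1"
  assumes "n \<ge> 2"
  shows "(monom 1 3 - monom g2 2 - monom g1 1 - monom g0 0) * (\<Sum>j\<le>n. monom (a j) j)
    = monom (a n) (n + 3) + monom (a (n - 1) - g2 * a n) (n + 2)
      + monom (a (n - 2) - g2 * a (n - 1) - g1 * a n) (n + 1)
      - (\<Sum>j\<le>n. monom (cubic_tail g2 g1 g0 a j) j)"
proof (rule poly_eqI)
  fix k
  have coeff_sum_monom: "coeff (\<Sum>j\<le>n. monom (b j) j) i = (if i \<le> n then b i else 0)"
    for b :: "nat \<Rightarrow> 'a" and i
    by (simp add: coeff_sum)
  consider "k \<le> n" | "k = n + 1" | "k = n + 2" | "k = n + 3" | "k > n + 3"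
    by linarith
  then show "coeff ((monom 1 3 - monom g2 2 - monom g1 1 - monom g0 0)
        * (\<Sum>j\<le>n. monom (a j) j)) k
    = coeff (monom (a n) (n + 3) + monom (a (n - 1) - g2 * a n) (n + 2)
      + monom (a (n - 2) - g2 * a (n - 1) - g1 * a n) (n + 1)
      - (\<Sum>j\<le>n. monom (cubic_tail g2 g1 g0 a j) j)) k"
    unfolding left_diff_distrib coeff_diff coeff_add coeff_monom_mult coeff_sum_monom coeff_monom
    using assms
    by cases (auto simp: cubic_tail_def numeral_eq_Suc Suc_diff_le)
qed

lemma of_real_cubic_tail:
  "of_real (cubic_tail g2 g1 g0 a j)
     = cubic_tail (of_real g2) (of_real g1) (of_real g0) (\<lambda>j. of_real (a j)) j"
  by (simp add: cubic_tail_def)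

text \<open>
  If \<open>g0 > 0\<close>, the cubic is negative at the origin. If \<open>g0 = 0\<close>, the origin is a zero, and a
  positive one has to come from the remaining quadratic factor, which is where the conditions on
  \<open>g1\<close> and \<open>g2\<close> enter.
\<close>

lemma cubic_positive_zero_exists:
  fixes g2 g1 g0 :: real
  assumes "g2 \<ge> 0" "g0 \<ge> 0" "g0 = 0 \<Longrightarrow> g1 \<ge> 0" "g0 = 0 \<Longrightarrow> g2 \<noteq> 0 \<or> g1 \<noteq> 0"
  shows "\<exists>x>0. x ^ 3 - g2 * x ^ 2 - g1 * x - g0 = 0"
proof (cases "g0 = 0")
  case True
  define x where "x = (g2 + sqrt (g2\<^sup>2 + 4 * g1)) / 2"
  have g1: "g1 \<ge> 0"
    using True assms(3) by simp
  have "x > 0"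
  proof (cases "g2 = 0")
    case True
    with g1 assms(4) \<open>g0 = 0\<close> show ?thesis
      by (simp add: x_def)
  next
    case False
    then have "g2 > 0"
      using assms(1) by simp
    then show ?thesis
      unfolding x_def using g1 by (intro divide_pos_pos add_pos_nonneg) auto
  qed
  have "2 * x - g2 = sqrt (g2\<^sup>2 + 4 * g1)"
    by (simp add: x_def field_simps)
  then have "(2 * x - g2)\<^sup>2 = g2\<^sup>2 + 4 * g1"
    using g1 by simp
  then have "x\<^sup>2 - g2 * x - g1 = 0"
    by (simp add: power2_eq_square algebra_simps)
  then have "x * (x\<^sup>2 - g2 * x - g1) = 0"
    by simp
  with \<open>x > 0\<close> True show ?thesis
    by (intro exI[of _ x]) (simp add: power2_eq_square power3_eq_cube algebra_simps)
next
  case False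
  define f where "f x = x ^ 3 - g2 * x ^ 2 - g1 * x - g0" for x
  \<comment> \<open>A Cauchy bound: the leading term absorbs all the others from here on.\<close>
  define M where "M = 1 + g2 + \<bar>g1\<bar> + g0"
  have M: "M \<ge> 1"
    using assms by (simp add: M_def)
  have "f M = M\<^sup>2 + (\<bar>g1\<bar> * M\<^sup>2 - g1 * M) + (g0 * M\<^sup>2 - g0)"
    by (simp add: f_def M_def power2_eq_square power3_eq_cube algebra_simps)
  moreover have "g1 * M \<le> \<bar>g1\<bar> * M\<^sup>2"
    using M by (intro mult_mono) (auto simp: power2_eq_square)
  moreover have "g0 * 1 \<le> g0 * M\<^sup>2"
    using M assms by (intro mult_left_mono) auto
  ultimately have "f M \<ge> 0"
    using zero_le_power2[of M] by linarith
  moreover have "f 0 \<le> 0"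
    using assms by (simp add: f_def)
  moreover have "continuous_on {0..M} f"
    unfolding f_def by (intro continuous_intros)
  ultimately obtain x where x: "0 \<le> x" "f x = 0"
    using M IVT'[of f 0 0 M] by auto
  moreover have "x \<noteq> 0"
    using x False by (auto simp: f_def)
  ultimately show ?thesis
    unfolding f_def by (intro exI[of _ x]) auto
qed

text \<open>
  Dividing by the factor of the positive zero \<open>m\<close> leaves \<open>w\<^sup>2 + b w + d\<close> with
  \<open>b = m - g2 \<le> m\<close> and \<open>d = g0 / m \<ge> 0\<close>. Two nonreal zeros of it have real part
  \<open>-b / 2\<close>; two real zeros have the same sign or vanish, as their product is \<open>d\<close>, and their sum
  \<open>-b\<close> is at least \<open>-m\<close>.
\<close>

lemma cubic_zero_Re_ge:
  fixes g2 g1 g0 m :: real and w :: complex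
  assumes "g2 \<ge> 0" "g0 \<ge> 0" "m > 0"
    and m: "m ^ 3 - g2 * m ^ 2 - g1 * m - g0 = 0"
    and w: "w ^ 3 - of_real g2 * w ^ 2 - of_real g1 * w - of_real g0 = 0"
  shows "Re w \<ge> - m"
proof (cases "w = of_real m")
  case True
  with assms show ?thesis by simp
next
  case False
  define b where "b = m - g2"
  define d where "d = g0 / m"
  have g2: "g2 = m - b" and g0: "g0 = m * d"
    using assms by (auto simp: b_def d_def)
  have "m * (g1 - (b * m - d)) = 0"
    using m by (simp add: g2 g0 power2_eq_square power3_eq_cube algebra_simps)
  then have g1: "g1 = b * m - d"
    using assms by simp
  have d: "d \<ge> 0"
    using assms by (simp add: d_def)
  have "(w - of_real m) * (w\<^sup>2 + of_real b * w + of_real d) = 0"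
    using w by (simp add: g2 g1 g0 power2_eq_square power3_eq_cube algebra_simps)
  with False have quad: "w\<^sup>2 + of_real b * w + of_real d = 0"
    by simp
  have re: "(Re w)\<^sup>2 - (Im w)\<^sup>2 + b * Re w + d = 0"
    using arg_cong[OF quad, of Re] by (simp add: power2_eq_square)
  have im: "Im w * (2 * Re w + b) = 0"
    using arg_cong[OF quad, of Im] by (simp add: power2_eq_square algebra_simps)
  show ?thesis
  proof (cases "Im w = 0")
    case True
    show ?thesis
    proof (rule ccontr)
      assume "\<not> ?thesis"
      then have "Re w < 0" "Re w + b < 0"
        using assms by (auto simp: b_def)
      then have "Re w * (Re w + b) > 0"
        by (rule mult_neg_neg)
      with re d True show False
        by (simp add: power2_eq_square algebra_simps)
    qed
  next
    case False
    with im have "2 * Re w + b = 0" by simp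
    with assms show ?thesis by (simp add: b_def)
  qed
qed

section \<open>Comparison of the two leading terms with a nonnegative tail\<close>

text \<open>
  Passing from \<open>m\<close> to a larger modulus multiplies each power by at most the factor of the highest
  power.
\<close>

lemma norm_sum_power_le:
  fixes z :: "'a::real_normed_field" and c :: "nat \<Rightarrow> real"
  assumes c: "\<And>j. j \<le> n \<Longrightarrow> c j \<ge> 0" and m: "0 < m" "m \<le> norm z"
  shows "norm (\<Sum>j\<le>n. of_real (c j) * z ^ j) \<le> (norm z / m) ^ n * (\<Sum>j\<le>n. c j * m ^ j)"
proof -
  have "norm (\<Sum>j\<le>n. of_real (c j) * z ^ j) \<le> (\<Sum>j\<le>n. (norm z / m) ^ n * (c j * m ^ j))"
  proof (rule sum_norm_le)
    fix j assume "j \<in> {..n}"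
    then have j: "j \<le> n" by simp
    have "norm (of_real (c j) * z ^ j) = (norm z / m) ^ j * (c j * m ^ j)"
      using c[OF j] m by (simp add: norm_mult norm_power power_divide)
    also have "\<dots> \<le> (norm z / m) ^ n * (c j * m ^ j)"
      using c[OF j] m j by (intro mult_right_mono power_increasing) auto
    finally show "norm (of_real (c j) * z ^ j) \<le> (norm z / m) ^ n * (c j * m ^ j)" .
  qed
  then show ?thesis
    by (simp add: sum_distrib_left)
qed

text \<open>
  At the zero \<open>m\<close> the sum is known exactly, so the previous estimate turns into a bound in which
  only the two leading coefficients occur.
\<close>

lemma tail_bound_beyond_positive_zero:
  fixes z :: "'a::real_normed_field" and c :: "nat \<Rightarrow> real"
  assumes c: "\<And>j. j \<le> n \<Longrightarrow> c j \<ge> 0" and m: "0 < m" "m \<le> norm z"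
    and zero: "A * m ^ (n + 3) + B * m ^ (n + 2) = (\<Sum>j\<le>n. c j * m ^ j)"
  shows "norm (\<Sum>j\<le>n. of_real (c j) * z ^ j) \<le> (A * m ^ 3 + B * m ^ 2) * norm z ^ n"
proof -
  have "(norm z / m) ^ n * (\<Sum>j\<le>n. c j * m ^ j) = (A * m ^ 3 + B * m ^ 2) * norm z ^ n"
    using m by (simp flip: zero add: power_add power_divide power2_eq_square field_simps)
  with norm_sum_power_le[of n c m z, OF c m] show ?thesis by simp
qed

text \<open>
  This is the case of Descartes' rule with a single sign change. From one positive zero to a later
  point \<open>v\<close> the right-hand side grows at most like \<open>v\<^sup>n\<close>, while the left-hand side grows
  strictly faster.
\<close>

lemma positive_zero_unique:
  fixes c :: "nat \<Rightarrow> real"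
  assumes c: "\<And>j. j \<le> n \<Longrightarrow> c j \<ge> 0" and "A > 0" "B \<ge> 0" and x: "x > 0" and y: "y > 0"
    and x_zero: "A * x ^ (n + 3) + B * x ^ (n + 2) = (\<Sum>j\<le>n. c j * x ^ j)"
    and y_zero: "A * y ^ (n + 3) + B * y ^ (n + 2) = (\<Sum>j\<le>n. c j * y ^ j)"
  shows "x = y"
proof -
  have no_later_zero: False
    if u: "u > 0" "u < v"
      and u_zero: "A * u ^ (n + 3) + B * u ^ (n + 2) = (\<Sum>j\<le>n. c j * u ^ j)"
      and v_zero: "A * v ^ (n + 3) + B * v ^ (n + 2) = (\<Sum>j\<le>n. c j * v ^ j)" for u v
  proof -
    have "A * v ^ (n + 3) + B * v ^ (n + 2) \<le> (A * u ^ 3 + B * u ^ 2) * v ^ n"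
      using tail_bound_beyond_positive_zero[of n c u v, OF c u(1) _ u_zero] u v_zero c
      by (simp add: abs_of_nonneg sum_nonneg)
    also have "\<dots> < (A * v ^ 3 + B * v ^ 2) * v ^ n"
      using assms(2,3) u
      by (intro mult_strict_right_mono add_less_le_mono mult_strict_left_mono mult_left_mono
          power_strict_mono power_mono) auto
    finally show False
      by (simp add: power_add power2_eq_square algebra_simps)
  qed
  show ?thesis
    using no_later_zero[OF x _ x_zero y_zero] no_later_zero[OF y _ y_zero x_zero]
    by (meson linorder_neqE_linordered_idom)
qed

section \<open>The zeros lie in two disks\<close>

theorem theorem5p2:
  fixes n :: nat and a :: "nat \<Rightarrow> real" and p :: "complex poly"
    and \<epsilon> \<gamma>0 \<gamma>1 \<gamma>2 \<mu> R :: real and q :: "real poly" and D0 D1 :: "complex set"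
  assumes n: "n \<ge> 3"
    and a_pos: "\<And>j. j \<le> n \<Longrightarrow> a j > 0"
    and p: "p = (\<Sum>j\<le>n. monom (complex_of_real (a j)) j)"
    and eps: "0 < \<epsilon>" "\<epsilon> \<le> 1"
    and \<gamma>2: "\<gamma>2 = (1 - \<epsilon>) * a (n - 1) / a n"
    and \<gamma>1: "\<gamma>1 = (a (n - 2) - \<gamma>2 * a (n - 1)) / a n"
    and \<gamma>0: "\<gamma>0 = Max {0, \<gamma>1 * a 0 / (- a 1), (\<gamma>2 * a 0 + \<gamma>1 * a 1) / (- a 2),
                 MAX j\<in>{0..n - 3}. (a j - \<gamma>2 * a (j + 1) - \<gamma>1 * a (j + 2)) / a (j + 3)}"
    and q: "q = monom 1 3 - monom \<gamma>2 2 - monom \<gamma>1 1 - monom \<gamma>0 0"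
    and \<mu>: "\<mu> = (THE x. x > 0 \<and> poly q x = 0)"
    and R: "R = \<mu> ^ 3 + (\<epsilon> * (a (n - 1) / a n)) * \<mu> ^ 2"
    and D0: "D0 = {z. cmod z \<le> R powr (1 / 3)}"
    and D1: "D1 = {z. cmod (z + complex_of_real (\<epsilon> * (a (n - 1) / a n))) \<le> R powr (1 / 3)}"
  shows "(\<exists>!x. x > 0 \<and> poly q x = 0)
    \<and> {z. poly p z = 0} \<subseteq> D0 \<union> D1
    \<and> (D0 \<inter> D1 = {} \<longrightarrow>
          size (filter_mset (\<lambda>z. z \<in> D1) (proots p)) = 1
        \<and> size (filter_mset (\<lambda>z. z \<in> D0) (proots p)) = n - 1)"
proof -
  define A where "A = a n"
  define s where "s = \<epsilon> * (a (n - 1) / a n)"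
  define \<rho> where "\<rho> = R powr (1 / 3)"
  define c where "c = cubic_tail \<gamma>2 \<gamma>1 \<gamma>0 a"
  have A: "A > 0"
    using a_pos by (simp add: A_def)
  have s: "s > 0"
    using a_pos eps by (simp add: s_def)
  have \<gamma>2_nonneg: "\<gamma>2 \<ge> 0"
    using a_pos[of n] a_pos[of "n - 1"] eps by (simp add: \<gamma>2)
  have top: "a (n - 1) - \<gamma>2 * a n = A * s"
    using a_pos[of n] by (simp add: \<gamma>2 A_def s_def field_simps)
  have next_top: "a (n - 2) - \<gamma>2 * a (n - 1) - \<gamma>1 * a n = 0"
    using a_pos[of n] by (simp add: \<gamma>1)

  let ?T = "\<lambda>j. (a j - \<gamma>2 * a (j + 1) - \<gamma>1 * a (j + 2)) / a (j + 3)"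
  have \<gamma>0_nonneg: "\<gamma>0 \<ge> 0"
    unfolding \<gamma>0 by (intro Max_ge) auto
  have tail0: "\<gamma>1 * a 0 + \<gamma>0 * a 1 \<ge> 0"
  proof -
    have "\<gamma>1 * a 0 / (- a 1) \<le> \<gamma>0"
      unfolding \<gamma>0 by (intro Max_ge) auto
    then show ?thesis
      using a_pos[of 1] n by (simp add: field_simps)
  qed
  have tail1: "\<gamma>2 * a 0 + \<gamma>1 * a 1 + \<gamma>0 * a 2 \<ge> 0"
  proof -
    have "(\<gamma>2 * a 0 + \<gamma>1 * a 1) / (- a 2) \<le> \<gamma>0"
      unfolding \<gamma>0 by (intro Max_ge) auto
    then show ?thesis
      using a_pos[of 2] n by (simp add: field_simps)
  qed
  have tail: "\<gamma>0 * a (j + 3) + \<gamma>1 * a (j + 2) + \<gamma>2 * a (j + 1) - a j \<ge> 0" if "j + 3 \<le> n" for j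
  proof -
    have "?T j \<le> Max (?T ` {0..n - 3})"
      using that by (intro Max_ge) auto
    also have "\<dots> \<le> \<gamma>0"
      unfolding \<gamma>0 by (intro Max_ge) auto
    finally show ?thesis
      using a_pos[OF that] by (simp add: field_simps)
  qed
  have c: "c j \<ge> 0" if "j \<le> n" for j
  proof -
    have "j = 0 \<or> j = 1 \<or> j = 2 \<or> j = (j - 3) + 3"
      by arith
    then consider "j = 0" | "j = 1" | "j = 2" | i where "j = i + 3"
      by blast
    then show ?thesis
    proof cases
      case 1
      then show ?thesis
        using \<gamma>0_nonneg a_pos[of 0] by (simp add: c_def cubic_tail_def)
    next
      case 2
      then show ?thesis
        using tail0 by (simp add: c_def cubic_tail_def)
    next
      case 3
      then show ?thesis
        using tail1 by (simp add: c_def cubic_tail_def add_ac)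
    next
      case (4 i)
      then show ?thesis
        using tail[of i] that
        by (simp add: c_def cubic_tail_def numeral_3_eq_3 numeral_2_eq_2 algebra_simps)
    qed
  qed

  define P where "P = (\<Sum>j\<le>n. monom (a j) j)"
  have q_mult: "q * P = monom A (n + 3) + monom (A * s) (n + 2) - (\<Sum>j\<le>n. monom (c j) j)"
    using cubic_mult_poly[of n \<gamma>2 \<gamma>1 \<gamma>0 a] n
    unfolding top next_top by (simp add: q P_def c_def A_def)
  define qc :: "complex poly" where
    "qc = monom 1 3 - monom (of_real \<gamma>2) 2 - monom (of_real \<gamma>1) 1 - monom (of_real \<gamma>0) 0"
  have qc_mult: "qc * p = monom (of_real A) (n + 3) + monom (of_real (A * s)) (n + 2)
      - (\<Sum>j\<le>n. monom (of_real (c j)) j)"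
  proof -
    have "complex_of_real (a (n - 1)) - of_real \<gamma>2 * of_real (a n) = of_real (A * s)"
      by (simp flip: top)
    moreover have "complex_of_real (a (n - 2)) - of_real \<gamma>2 * of_real (a (n - 1))
        - of_real \<gamma>1 * of_real (a n) = 0"
      using arg_cong[OF next_top, of complex_of_real] by simp
    ultimately show ?thesis
      using cubic_mult_poly[of n "complex_of_real \<gamma>2" "of_real \<gamma>1" "of_real \<gamma>0"
          "\<lambda>j. of_real (a j)"] n
      by (simp add: qc_def p c_def of_real_cubic_tail A_def)
  qed

  have poly_q: "poly q x = x ^ 3 - \<gamma>2 * x ^ 2 - \<gamma>1 * x - \<gamma>0" for x
    by (simp add: q poly_monom)
  have q_zero: "A * x ^ (n + 3) + (A * s) * x ^ (n + 2) = (\<Sum>j\<le>n. c j * x ^ j)"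
    if "poly q x = 0" for x
  proof -
    have "poly (q * P) x = 0"
      using that by simp
    then show ?thesis
      unfolding q_mult by (simp add: poly_monom poly_sum)
  qed
  have ex1: "\<exists>!x. x > 0 \<and> poly q x = 0"
  proof (rule ex_ex1I)
    \<comment> \<open>The cubic does not degenerate to \<open>z\<^sup>3\<close>: \<open>\<gamma>2 = \<gamma>1 = 0\<close> would force
        \<open>a\<^bsub>n-2\<^esub> = 0\<close>.\<close>
    have "\<gamma>1 \<ge> 0" if "\<gamma>0 = 0"
      using tail0 that a_pos[of 0] by (simp add: zero_le_mult_iff)
    moreover have "\<gamma>2 \<noteq> 0 \<or> \<gamma>1 \<noteq> 0"
      using next_top a_pos[of "n - 2"] by auto
    ultimately show "\<exists>x. x > 0 \<and> poly q x = 0"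
      unfolding poly_q by (intro cubic_positive_zero_exists \<gamma>2_nonneg \<gamma>0_nonneg)
  next
    fix x y assume "x > 0 \<and> poly q x = 0" "y > 0 \<and> poly q y = 0"
    then show "x = y"
      using A s by - (rule positive_zero_unique[OF c A _ _ _ q_zero q_zero], auto)
  qed
  have "\<mu> > 0 \<and> poly q \<mu> = 0"
    unfolding \<mu> by (rule theI'[OF ex1])
  then have \<mu>_pos: "\<mu> > 0" and \<mu>_zero: "poly q \<mu> = 0"
    by auto

  have R': "R = \<mu> ^ 3 + s * \<mu> ^ 2"
    by (simp add: R s_def)
  have R_pos: "R > 0"
    using \<mu>_pos s by (simp add: R' add_pos_pos)
  have \<rho>_pos: "\<rho> > 0"
    using R_pos by (simp add: \<rho>_def)
  have \<rho>_cube: "\<rho> ^ 3 = R"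
    using R_pos by (simp add: \<rho>_def flip: powr_numeral powr_realpow add: powr_powr)
  have \<mu>_le: "\<mu> \<le> \<rho>"
  proof (rule power_le_imp_le_base)
    show "\<mu> ^ Suc 2 \<le> \<rho> ^ Suc 2"
      using \<rho>_cube R' s by (simp add: numeral_3_eq_3 numeral_2_eq_2)
  qed (use \<rho>_pos in simp)
  have D0': "z \<in> D0 \<longleftrightarrow> cmod z \<le> \<rho>" for z
    by (simp add: D0 \<rho>_def)
  have D1': "z \<in> D1 \<longleftrightarrow> cmod (z + of_real s) \<le> \<rho>" for z
    by (simp add: D1 \<rho>_def s_def)

  define G where "G = - (\<Sum>j\<le>n. monom (complex_of_real (c j)) j)"
  define F where "F = monom (complex_of_real A) (n + 2) * [:of_real s, 1:]"
  have qcp: "qc * p = F + G"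
  proof -
    have "[:complex_of_real s, 1:] = monom 1 1 + monom (of_real s) 0"
      by (simp add: monom_Suc monom_0)
    then have "F = monom (of_real A) (n + 3) + monom (of_real (A * s)) (n + 2)"
      by (simp add: F_def distrib_left mult_monom numeral_3_eq_3)
    then show ?thesis
      by (simp add: qc_mult G_def)
  qed
  have poly_F: "cmod (poly F z) = A * cmod z ^ n * (cmod z ^ 2 * cmod (z + of_real s))" for z
  proof -
    have "poly F z = of_real A * z ^ n * (z ^ 2 * (z + of_real s))"
      by (simp add: F_def poly_monom power_add power2_eq_square algebra_simps)
    then show ?thesis
      using A by (simp add: norm_mult norm_power)
  qed
  have poly_G: "cmod (poly G z) \<le> A * cmod z ^ n * R" if "cmod z \<ge> \<mu>" for z
    using tail_bound_beyond_positive_zero[OF c \<mu>_pos that q_zero[OF \<mu>_zero]]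
    by (simp add: G_def poly_sum poly_monom R' algebra_simps)

  have G_less_F: "cmod (poly G z) < cmod (poly F z)"
    if out: "cmod z > \<rho>" "cmod (z + of_real s) > \<rho>" for z
  proof -
    have "\<rho> ^ 2 * \<rho> < cmod z ^ 2 * cmod (z + of_real s)"
      using out \<rho>_pos by (intro mult_strict_mono power_strict_mono) auto
    then have "R < cmod z ^ 2 * cmod (z + of_real s)"
      using \<rho>_cube by (simp add: power2_eq_square power3_eq_cube)
    moreover have "A * cmod z ^ n > 0"
      using A out \<rho>_pos by (intro mult_pos_pos zero_less_power) auto
    ultimately have "A * cmod z ^ n * R < cmod (poly F z)"
      unfolding poly_F by (rule mult_strict_left_mono)
    with poly_G[of z] out \<mu>_le show ?thesis
      by simp
  qed

  have zeros: "z \<in> D0 \<union> D1" if "poly p z = 0" for z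
  proof (rule ccontr)
    assume "z \<notin> D0 \<union> D1"
    then have "cmod (poly G z) < cmod (poly F z)"
      by (intro G_less_F) (auto simp: D0' D1')
    moreover have "poly F z + poly G z = 0"
      using that by (simp flip: poly_add qcp)
    then have "cmod (poly F z) = cmod (poly G z)"
      by (simp add: add_eq_0_iff)
    ultimately show False by simp
  qed

  have "size (filter_mset (\<lambda>z. z \<in> D1) (proots p)) = 1
      \<and> size (filter_mset (\<lambda>z. z \<in> D0) (proots p)) = n - 1" if disj: "D0 \<inter> D1 = {}"
  proof -
    have s_gt: "s / 2 > \<rho>"
    proof (rule ccontr)
      assume "\<not> ?thesis"
      \<comment> \<open>Otherwise the midpoint of the two centres lies in both disks.\<close>
      then have "- of_real (s / 2) \<in> D0 \<inter> D1"
        using s by (simp add: D0' D1' flip: of_real_add of_real_minus of_real_diff)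
      with disj show False by blast
    qed
    define B where "B = ball (- complex_of_real s) (s / 2)"
    have dist_centre: "dist (- complex_of_real s) z = cmod (z + of_real s)" for z
      using norm_minus_commute[of "- complex_of_real s" z] by (simp add: dist_norm)
    have B: "z \<in> B \<longleftrightarrow> cmod (z + of_real s) < s / 2" for z
      by (simp add: B_def dist_centre)
    have far: "cmod z \<ge> s - cmod (z + of_real s)" for z
      using norm_triangle_ineq4[of "z + of_real s" z] s by simp

    have count: "size (filter_mset (\<lambda>z. z \<in> B) (proots (F + G)))
        = size (filter_mset (\<lambda>z. z \<in> B) (proots F))"
      unfolding B_def
    proof (rule Rouche_theorem_poly)
      fix z assume "z \<in> sphere (- complex_of_real s) (s / 2)"
      then have on: "cmod (z + of_real s) = s / 2"
        by (simp add: dist_centre)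
      then show "cmod (poly G z) < cmod (poly F z)"
        using far[of z] s_gt by (intro G_less_F) auto
    qed (use s in simp)

    have F_count: "size (filter_mset (\<lambda>z. z \<in> B) (proots F)) = 1"
    proof -
      have "filter_mset (\<lambda>z. z \<in> B) (proots (monom (complex_of_real A) (n + 2))) = {#}"
        using A s by (auto simp: poly_monom monom_eq_0_iff B)
      moreover have "- of_real s \<in> B"
        using s by (simp add: B)
      moreover have "proots F = proots (monom (complex_of_real A) (n + 2)) + {#- of_real s#}"
        unfolding F_def by (subst proots_mult) (use A in \<open>auto simp: monom_eq_0_iff\<close>)
      ultimately show ?thesis
        by simp
    qed

    have p_nz: "p \<noteq> 0" and qc_nz: "qc \<noteq> 0"
    proof -
      have "coeff p n = of_real A"
        by (simp add: p coeff_sum A_def)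
      then show "p \<noteq> 0"
        using A by auto
      have "coeff qc 3 = 1"
        by (simp add: qc_def)
      then show "qc \<noteq> 0"
        by auto
    qed
    have qc_B: "filter_mset (\<lambda>z. z \<in> B) (proots qc) = {#}"
    proof -
      have "w \<notin> B" if "poly qc w = 0" for w
      proof
        assume "w \<in> B"
        then have "Re (w + of_real s) < s / 2"
          using complex_Re_le_cmod[of "w + of_real s"] by (simp add: B)
        moreover have "Re w \<ge> - \<mu>"
          using that \<mu>_zero
          by (intro cubic_zero_Re_ge[OF \<gamma>2_nonneg \<gamma>0_nonneg \<mu>_pos, of \<gamma>1])
            (auto simp: poly_q qc_def poly_monom)
        ultimately show False
          using s_gt \<mu>_le by simp
      qed
      then show ?thesis
        using qc_nz by auto
    qed
    have "size (filter_mset (\<lambda>z. z \<in> B) (proots p)) = 1"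
      using count F_count qc_B p_nz qc_nz by (simp add: proots_mult flip: qcp)
    moreover have "filter_mset (\<lambda>z. z \<in> B) (proots p) = filter_mset (\<lambda>z. z \<in> D1) (proots p)"
    proof (rule filter_mset_cong)
      fix z assume "z \<in># proots p"
      then have "z \<in> D0 \<union> D1"
        using zeros p_nz by simp
      then show "z \<in> B \<longleftrightarrow> z \<in> D1"
        using s_gt far[of z] by (auto simp: B D0' D1')
    qed simp
    ultimately have D1_count: "size (filter_mset (\<lambda>z. z \<in> D1) (proots p)) = 1"
      by simp
    have "filter_mset (\<lambda>z. z \<in> D0) (proots p) = filter_mset (\<lambda>z. z \<notin> D1) (proots p)"
      using zeros p_nz disj by (intro filter_mset_cong) auto
    moreover have "size (proots p) = n"
    proof -
      have "degree p = n"
      proof (rule antisym)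
        show "degree p \<le> n"
          unfolding p by (intro degree_sum_le) (auto intro: order_trans[OF degree_monom_le])
        show "n \<le> degree p"
          using A by (intro le_degree) (simp add: p coeff_sum A_def)
      qed
      then show ?thesis
        by (simp add: size_proots_complex)
    qed
    moreover have "size (proots p) = size (filter_mset (\<lambda>z. z \<in> D1) (proots p))
        + size (filter_mset (\<lambda>z. z \<notin> D1) (proots p))"
      by (metis multiset_partition size_union)
    ultimately show ?thesis
      using D1_count by simp
  qed
  with ex1 zeros show ?thesis
    by blast
qed

end
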